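(* A function $g:(0,+\infty)\to\mathbb{R}$ is an anti-Löwner function on $(0,+\infty)$ (that is, of every order) if and only if there exist real numbers $\alpha,\beta\ge0$ and a positive Borel measure $\mu$ on $(0,+\infty)$ such that, for every $x>0$, the integral below converges and $$g(x)=\frac{\alpha}{x}+\beta x+\int_0^\infty\frac{x}{t+x^2}\,d\mu(t).$$
   Context: For a function $g:(0,+\infty)\to\mathbb{R}$, an integer $N\ge1$ and distinct points $x_1,\ldots,x_N\in(0,+\infty)$, the anti-Löwner matrix of $g$ at these points is the $N\times N$ real symmetric matrix $K_g=\left(\frac{g(x_i)+g(x_j)}{x_i+x_j}\right)_{i,j=1}^N$. The function $g$ is called an anti-Löwner function if $K_g$ is positive semidefinite for every integer $N\ge1$ and every choice of distinct points $x_1,\ldots,x_N\in(0,+\infty)$. *)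

theory Defs
  imports "HOL-Analysis.Analysis" "Jordan_Normal_Form.Matrix"
begin

text \<open>A function on \<open>(0, \<infinity>)\<close> is represented by a total function \<^typ>\<open>real \<Rightarrow> real\<close>
  of which only the values on \<^term>\<open>{0::real<..}\<close> are ever used.\<close>

definition positive_semidefinite :: "real mat \<Rightarrow> bool" where
  "positive_semidefinite A \<longleftrightarrow>
     A \<in> carrier_mat (dim_row A) (dim_row A) \<and> transpose_mat A = A \<and>
     (\<forall>v \<in> carrier_vec (dim_row A). scalar_prod v (A *\<^sub>v v) \<ge> 0)"

definition anti_loewner_matrix :: "(real \<Rightarrow> real) \<Rightarrow> nat \<Rightarrow> (nat \<Rightarrow> real) \<Rightarrow> real mat" where
  "anti_loewner_matrix g N x = mat N N (\<lambda>(i, j). (g (x i) + g (x j)) / (x i + x j))"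

definition anti_loewner :: "(real \<Rightarrow> real) \<Rightarrow> bool" where
  "anti_loewner g \<longleftrightarrow>
     (\<forall>N\<ge>1. \<forall>x. inj_on x {..<N} \<and> x ` {..<N} \<subseteq> {0<..} \<longrightarrow>
        positive_semidefinite (anti_loewner_matrix g N x))"

end

theory Submission
  imports Defs "HOL-Probability.Probability" "HOL-Computational_Algebra.Fundamental_Theorem_Algebra"
begin

text \<open>Write \<open>k\<^sub>t(x) = x / (t + x\<^sup>2)\<close>. The quadratic form of the matrix of \<open>g\<close> is linear in \<open>g\<close>, and for
  \<open>g = k\<^sub>t\<close> it equals \<open>t A\<^sup>2 + B\<^sup>2\<close>; integrating in \<open>t\<close> shows that the representation is sufficient.

  For necessity normalise \<open>g(1) = 1\<close>. With \<open>u = t / (1 + t)\<close> the functions \<open>1/x\<close>, \<open>(1 + t) k\<^sub>t(x)\<close>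
  and \<open>x\<close> become one family indexed by the compact interval \<open>[0, 1]\<close>, all of value 1 at \<open>x = 1\<close>.
  Given finitely many points, choose a probability measure on \<open>[0, 1]\<close> that minimises the squared
  error of interpolating \<open>g\<close> there. If the error were positive, the first-order condition would give
  coefficients \<open>c\<close> with \<open>\<Sum> c\<^sub>x k\<^sub>t(x) \<ge> 0\<close> for all \<open>t \<ge> 0\<close> but \<open>\<Sum> c\<^sub>x g(x) < 0\<close>. Clearing denominators
  in the first sum gives a polynomial \<open>p\<close> that is nonnegative on \<open>[0, \<infinity>)\<close>; it factors as
  \<open>p(-z\<^sup>2) = r(z) r(-z)\<close>, and Lagrange interpolation of \<open>r\<close> exhibits \<open>c\<close> as the coefficients of a
  quadratic form of \<open>g\<close>, a contradiction. A Helly limit then interpolates \<open>g\<close> at all positive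
  rationals, and \<open>g\<close> is continuous because \<open>x g(x)\<close> increases and \<open>g(x)/x\<close> decreases.\<close>

subsection \<open>Real polynomials nonnegative on a half-line\<close>

lemma map_poly_of_real_add:
  "map_poly of_real (p + q) = (map_poly of_real p + map_poly of_real q :: 'a::real_algebra_1 poly)"
  by (intro poly_eqI) (simp add: coeff_map_poly)

lemma map_poly_of_real_mult:
  "map_poly of_real (p * q) =
    (map_poly of_real p * map_poly of_real q :: 'a::{real_algebra_1, comm_semiring_1} poly)"
  by (intro poly_eqI) (simp add: coeff_map_poly coeff_mult)

lemma poly_map_poly_of_real:
  "poly (map_poly of_real p) (of_real x) = (of_real (poly p x) :: 'a::{real_algebra_1, comm_semiring_1})"
  by (induction p) (auto simp: map_poly_pCons)

text \<open>The quadratic has roots \<open>w\<close> and its conjugate. The remainder modulo it is a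
  real polynomial of degree at most 1 vanishing at the non-real \<open>w\<close>, hence
  zero.\<close>

lemma real_poly_nonreal_root_dvd:
  fixes p :: "real poly"
  assumes root: "poly (map_poly complex_of_real p) w = 0" and "Im w \<noteq> 0"
  shows "[: (cmod w)\<^sup>2, - 2 * Re w, 1 :] dvd p"
proof -
  define q where "q = [: (cmod w)\<^sup>2, - 2 * Re w, 1 :]"
  have [simp]: "q \<noteq> 0" "degree q = 2" by (auto simp: q_def)
  have q0: "poly (map_poly complex_of_real q) w = 0"
    by (simp add: q_def map_poly_pCons cmod_power2 complex_eq_iff)
      (simp add: power2_eq_square algebra_simps)
  define r where "r = p mod q"
  have "degree r \<le> 1"
    using degree_mod_less[of q p] by (auto simp: r_def)
  then obtain a b where r: "r = [:a, b:]"
    by (cases r rule: pCons_cases) (fastforce split: if_splits elim: degree_eq_zeroE)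
  have "p = q * (p div q) + r"
    by (simp add: r_def)
  then have "map_poly complex_of_real p = map_poly of_real q * map_poly of_real (p div q) + map_poly of_real r"
    by (metis map_poly_of_real_add map_poly_of_real_mult)
  with root q0 have "poly (map_poly complex_of_real r) w = 0"
    by simp
  with \<open>Im w \<noteq> 0\<close> have "r = 0"
    by (auto simp: r map_poly_pCons complex_eq_iff)
  then show ?thesis
    by (simp add: r_def q_def mod_eq_0_iff_dvd)
qed

lemma poly_nonneg_at_left_endpoint:
  fixes q :: "real poly"
  assumes "a < b" and "\<And>t. a < t \<Longrightarrow> t < b \<Longrightarrow> 0 \<le> poly q t"
  shows "0 \<le> poly q a"
proof (rule tendsto_lowerbound)
  show "(poly q \<longlongrightarrow> poly q a) (at_right a)"
    using poly_isCont[of a q] by (simp add: isCont_def filterlim_at_split)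
  show "eventually (\<lambda>t. 0 \<le> poly q t) (at_right a)"
    using assms by (auto simp: eventually_at_right_field)
qed simp

text \<open>A spectral factorisation: on the imaginary axis it reads
  \<open>p(y^2) = |r(iy)|^2\<close>. By induction on the degree, one splits off a factor of
  \<open>p\<close> that is nonnegative on the half-line and has an explicit \<open>r\<close> of its
  own.\<close>

lemma poly_nonneg_imp_reflection_product:
  fixes p :: "real poly"
  assumes "\<And>t. t \<ge> 0 \<Longrightarrow> poly p t \<ge> 0"
  shows "\<exists>r. degree r \<le> degree p \<and> (\<forall>z. poly r z * poly r (-z) = poly p (-(z\<^sup>2)))"
  using assms
proof (induction "degree p" arbitrary: p rule: less_induct)
  case less
  have step: "\<exists>r. degree r \<le> degree p \<and> (\<forall>z. poly r z * poly r (-z) = poly p (-(z\<^sup>2)))"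
    if p: "p = a * q" and dega: "degree a > 0" and s: "degree s \<le> degree a"
      and as: "\<And>z. poly s z * poly s (-z) = poly a (-(z\<^sup>2))"
      and pos: "\<And>t. t > 0 \<Longrightarrow> poly a t \<ge> 0" for a q s
  proof (cases "p = 0")
    case True
    then show ?thesis by (intro exI[of _ 0]) simp
  next
    case False
    then have deg: "degree p = degree a + degree q" using p by (auto simp: degree_mult_eq)
    have q_pos: "poly q t \<ge> 0" if "t > 0" "poly a t \<noteq> 0" for t
      using less.prems[of t] pos[of t] that p
      by (auto simp: zero_le_mult_iff)
    \<comment> \<open>At a root of \<open>a\<close> the sign of \<open>q\<close> cannot be found by
      division. As \<open>a\<close> has finitely many roots, \<open>q\<close> is nonnegative just to
      the right of \<open>t\<close>, and continuity does the rest.\<close>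
    have "poly q t \<ge> 0" if "t \<ge> 0" for t
    proof (rule tendsto_lowerbound)
      show "(poly q \<longlongrightarrow> poly q t) (at_right t)"
        using poly_isCont[of t q] by (simp add: isCont_def filterlim_at_split)
      have "finite {u. poly a u = 0}"
        using dega by (intro poly_roots_finite) auto
      then have "open (- ({u. poly a u = 0} - {t}))"
        by (intro open_Compl finite_imp_closed) auto
      then have "eventually (\<lambda>u. u \<in> - ({u. poly a u = 0} - {t})) (at t within {t<..})"
        unfolding eventually_at_topological by blast
      moreover have "eventually (\<lambda>u. u > t) (at_right t)"
        by (simp add: eventually_at_right_less)
      ultimately show "eventually (\<lambda>u. poly q u \<ge> 0) (at_right t)"
        by eventually_elim (use \<open>t \<ge> 0\<close> in \<open>auto intro: q_pos\<close>)
    qed simp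
    with less.hyps[of q] obtain r where r: "degree r \<le> degree q"
      "\<And>z. poly r z * poly r (-z) = poly q (-(z\<^sup>2))"
      using deg dega by auto
    show ?thesis
    proof (intro exI[of _ "s * r"] conjI allI)
      show "degree (s * r) \<le> degree p"
        using degree_mult_le[of s r] s r(1) deg by linarith
      fix z
      have "poly (s * r) z * poly (s * r) (-z) = (poly s z * poly s (-z)) * (poly r z * poly r (-z))"
        by (simp add: algebra_simps)
      then show "poly (s * r) z * poly (s * r) (-z) = poly p (-(z\<^sup>2))"
        by (simp add: as r(2) p)
    qed
  qed
  show ?case
  proof (cases "degree p = 0")
    case True
    then obtain a where a: "p = [:a:]" by (rule degree_eq_zeroE)
    with less.prems[of 0] have "a \<ge> 0" by simp
    then show ?thesis by (intro exI[of _ "[:sqrt a:]"]) (simp add: a)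
  next
    case False
    have "degree (map_poly complex_of_real p) = degree p"
      by (rule degree_map_poly) auto
    with False have "\<not> constant (poly (map_poly complex_of_real p))"
      by (simp add: constant_degree)
    then obtain w where w: "poly (map_poly complex_of_real p) w = 0"
      using fundamental_theorem_of_algebra by blast
    define a where "a = [: (cmod w)\<^sup>2, - 2 * Re w, 1 :]"
    have real_dvd: "[: - Re w, 1 :] dvd p" if "Im w = 0"
    proof -
      have "w = complex_of_real (Re w)" using that by (simp add: complex_eq_iff)
      then have "poly p (Re w) = 0"
        using w by (metis of_real_eq_0_iff poly_map_poly_of_real)
      then show ?thesis by (simp add: poly_eq_0_iff_dvd)
    qed
    show ?thesis
    proof (cases "Im w = 0 \<and> Re w \<le> 0")
      case True
      with real_dvd obtain q where q: "p = [: - Re w, 1 :] * q" by (auto elim: dvdE)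
      \<comment> \<open>With \<open>c = - Re w\<close>, the factor \<open>t + c\<close> at
        \<open>t = -z^2\<close> is \<open>(sqrt c + z) (sqrt c - z)\<close>.\<close>
      show ?thesis
        by (rule step[OF q, of "[: sqrt (- Re w), 1 :]"])
          (use True in \<open>auto simp: algebra_simps power2_eq_square real_sqrt_mult_self\<close>)
    next
      case False
      have "a dvd p"
      proof (cases "Im w = 0")
        case True
        with False have "Re w > 0" by simp
        from True real_dvd obtain q where q: "p = [: - Re w, 1 :] * q" by (auto elim: dvdE)
        \<comment> \<open>A positive real root is at least double: \<open>t - Re w\<close> changes
          sign there and \<open>p\<close> does not, so \<open>q\<close> is nonnegative on the right
          and nonpositive on the left, hence zero at the root. The left side is handled by
          reflecting the variable.\<close>
        have "poly q (Re w) \<ge> 0"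
        proof (rule poly_nonneg_at_left_endpoint)
          show "Re w < Re w + 1" by simp
          fix t assume "Re w < t"
          moreover have "poly p t = (t - Re w) * poly q t" by (simp add: q algebra_simps)
          ultimately show "0 \<le> poly q t"
            using less.prems[of t] \<open>Re w > 0\<close> by (simp add: zero_le_mult_iff)
        qed
        moreover have "poly (- q \<circ>\<^sub>p [:0, -1:]) (- Re w) \<ge> 0"
        proof (rule poly_nonneg_at_left_endpoint)
          show "- Re w < 0" using \<open>Re w > 0\<close> by simp
          fix t assume "- Re w < t" "t < 0"
          moreover have "poly p (- t) = (- t - Re w) * poly q (- t)" by (simp add: q algebra_simps)
          ultimately show "0 \<le> poly (- q \<circ>\<^sub>p [:0, -1:]) t"
            using less.prems[of "- t"] by (simp add: zero_le_mult_iff poly_pcompose)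
        qed
        ultimately have "poly q (Re w) = 0" by (simp add: poly_pcompose)
        then obtain q' where q': "q = [: - Re w, 1 :] * q'"
          by (auto simp: poly_eq_0_iff_dvd elim: dvdE)
        have "a = [: - Re w, 1 :] * [: - Re w, 1 :]"
          using True by (simp add: a_def cmod_power2) (simp add: power2_eq_square)
        then have "p = a * q'"
          by (simp only: q q' mult.assoc)
        then show ?thesis by simp
      qed (unfold a_def, rule real_poly_nonreal_root_dvd[OF w])
      then obtain q where q: "p = a * q" by (auto elim: dvdE)
      show ?thesis
        \<comment> \<open>At \<open>-z\<^sup>2\<close> the factor \<open>a\<close> is \<open>z\<^sup>4 + 2 Re w z\<^sup>2 + |w|\<^sup>2 = (z\<^sup>2 + |w|)\<^sup>2 - (2|w| - 2 Re w) z\<^sup>2\<close>.\<close>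
      proof (rule step[OF q, of "[: cmod w, sqrt (2 * cmod w - 2 * Re w), 1 :]"])
        have "poly a t = (t - Re w)\<^sup>2 + (Im w)\<^sup>2" for t
          by (simp add: a_def cmod_power2) (simp add: power2_eq_square algebra_simps)
        then show "0 \<le> poly a t" for t by simp
        define d where "d = sqrt (2 * cmod w - 2 * Re w)"
        have d: "d * d = 2 * cmod w - 2 * Re w"
          using complex_Re_le_cmod[of w] by (simp add: d_def)
        have "poly [: cmod w, d, 1 :] z * poly [: cmod w, d, 1 :] (- z) = (z * z + cmod w)\<^sup>2 - (d * d) * z\<^sup>2" for z
          by (simp add: power2_eq_square algebra_simps)
        also have "\<dots> z = poly a (-(z\<^sup>2))" for z
          unfolding d by (simp add: a_def power2_eq_square algebra_simps)
        finally show "poly [: cmod w, sqrt (2 * cmod w - 2 * Re w), 1 :] z *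
            poly [: cmod w, sqrt (2 * cmod w - 2 * Re w), 1 :] (- z) = poly a (-(z\<^sup>2))" for z
          by (simp add: d_def)
      qed (auto simp: a_def)
    qed
  qed
qed

subsection \<open>The quadratic form as a linear functional of the function\<close>

text \<open>The weight of \<open>g x\<close> in the quadratic form of the matrix of \<open>g\<close>
  on the points \<open>X\<close> at the vector \<open>\<xi>\<close>; the factor 2 reflects the
  symmetry of the matrix.\<close>

definition loewner_coeff :: "real set \<Rightarrow> (real \<Rightarrow> real) \<Rightarrow> real \<Rightarrow> real" where
  "loewner_coeff X \<xi> x = 2 * \<xi> x * (\<Sum>y\<in>X. \<xi> y / (x + y))"

lemma anti_loewner_form_eq:
  "(\<Sum>x\<in>X. \<Sum>y\<in>X. \<xi> x * \<xi> y * ((g x + g y) / (x + y))) = (\<Sum>x\<in>X. loewner_coeff X \<xi> x * g x)"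
proof -
  have "(\<Sum>x\<in>X. \<Sum>y\<in>X. \<xi> x * \<xi> y * ((g x + g y) / (x + y)))
      = (\<Sum>x\<in>X. \<Sum>y\<in>X. \<xi> x * g x * (\<xi> y / (x + y))) + (\<Sum>x\<in>X. \<Sum>y\<in>X. \<xi> y * g y * (\<xi> x / (y + x)))"
    by (simp add: add_divide_distrib algebra_simps flip: sum.distrib)
  also have "(\<Sum>x\<in>X. \<Sum>y\<in>X. \<xi> y * g y * (\<xi> x / (y + x))) = (\<Sum>x\<in>X. \<Sum>y\<in>X. \<xi> x * g x * (\<xi> y / (x + y)))"
    by (rule sum.swap)
  finally show ?thesis
    by (simp add: loewner_coeff_def sum_distrib_left sum_distrib_right algebra_simps flip: sum.distrib)
qed

text \<open>Removes matrices and enumerations of points: a vector becomes a function on a finite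
  set. The empty set, absent from the definition, only adds an empty sum.\<close>

lemma anti_loewner_iff:
  "anti_loewner g \<longleftrightarrow>
    (\<forall>X \<xi>. finite X \<longrightarrow> X \<subseteq> {0<..} \<longrightarrow> 0 \<le> (\<Sum>x\<in>X. loewner_coeff X \<xi> x * g x))"
proof -
  have quad: "scalar_prod v (anti_loewner_matrix g N x *\<^sub>v v) =
      (\<Sum>i<N. \<Sum>j<N. v $ i * v $ j * ((g (x i) + g (x j)) / (x i + x j)))"
    if "v \<in> carrier_vec N" for v N x
    using that
    by (auto simp: scalar_prod_def anti_loewner_matrix_def sum_distrib_left mult.commute
        mult.left_commute atLeast0LessThan intro!: sum.cong)
  have sym: "transpose_mat (anti_loewner_matrix g N x) = anti_loewner_matrix g N x" for N x
    by (auto simp: anti_loewner_matrix_def add.commute)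
  have dim: "dim_row (anti_loewner_matrix g N x) = N"
    "anti_loewner_matrix g N x \<in> carrier_mat N N" for N x
    by (auto simp: anti_loewner_matrix_def)
  have reindex: "(\<Sum>i<N. \<Sum>j<N. v i * v j * ((g (x i) + g (x j)) / (x i + x j)))
      = (\<Sum>y\<in>X. loewner_coeff X \<xi> y * g y)"
    if "bij_betw x {..<N} X" "\<And>i. i < N \<Longrightarrow> \<xi> (x i) = v i" for v \<xi> :: "_ \<Rightarrow> real" and N x X
    unfolding anti_loewner_form_eq[symmetric]
    using that(2) by (simp add: sum.reindex_bij_betw[OF that(1), symmetric])
  show ?thesis
  proof (intro iffI allI impI)
    fix X :: "real set" and \<xi>
    assume g: "anti_loewner g" and X: "finite X" "X \<subseteq> {0<..}"
    show "0 \<le> (\<Sum>x\<in>X. loewner_coeff X \<xi> x * g x)"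
    proof (cases "X = {}")
      case False
      then have "1 \<le> card X"
        using X(1) by (simp add: Suc_le_eq card_gt_0_iff)
      obtain x where x: "bij_betw x {..<card X} X"
        using ex_bij_betw_nat_finite[OF X(1)] by (auto simp: atLeast0LessThan)
      then have "positive_semidefinite (anti_loewner_matrix g (card X) x)"
        using g X(2) \<open>1 \<le> card X\<close> unfolding anti_loewner_def bij_betw_def by blast
      then have "0 \<le> scalar_prod (vec (card X) (\<xi> \<circ> x)) (anti_loewner_matrix g (card X) x *\<^sub>v vec (card X) (\<xi> \<circ> x))"
        by (simp add: positive_semidefinite_def dim)
      also have "\<dots> = (\<Sum>y\<in>X. loewner_coeff X \<xi> y * g y)"
        by (subst quad) (auto intro!: reindex[OF x, of \<xi>, THEN trans[rotated]] sum.cong)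
      finally show ?thesis .
    qed simp
  next
    assume *: "\<forall>X \<xi>. finite X \<longrightarrow> X \<subseteq> {0<..} \<longrightarrow> 0 \<le> (\<Sum>x\<in>X. loewner_coeff X \<xi> x * g x)"
    show "anti_loewner g"
      unfolding anti_loewner_def positive_semidefinite_def dim sym
    proof (intro allI impI conjI ballI)
      fix N and x :: "nat \<Rightarrow> real" and v :: "real vec"
      assume x: "inj_on x {..<N} \<and> x ` {..<N} \<subseteq> {0<..}" and v: "v \<in> carrier_vec N"
      have "0 \<le> (\<Sum>y\<in>x ` {..<N}. loewner_coeff (x ` {..<N}) (\<lambda>y. v $ the_inv_into {..<N} x y) y * g y)"
        using * x by blast
      also have "\<dots> = (\<Sum>i<N. \<Sum>j<N. v $ i * v $ j * ((g (x i) + g (x j)) / (x i + x j)))"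
        using x by (intro reindex[symmetric]) (auto simp: bij_betw_def the_inv_into_f_f)
      finally show "0 \<le> scalar_prod v (anti_loewner_matrix g N x *\<^sub>v v)"
        by (simp add: quad[OF v])
    qed (auto simp: dim sym)
  qed
qed

text \<open>Since \<open>x (t + y^2) + y (t + x^2) = (x + y) (t + x y)\<close>, the matrix of each
  kernel is a sum of two rank-one matrices. The case \<open>t = 0\<close> covers
  \<open>1 / x\<close>.\<close>

lemma loewner_coeff_sum_kernel:
  assumes X: "finite X" "X \<subseteq> {0<..}" and "t \<ge> 0"
  shows "(\<Sum>x\<in>X. loewner_coeff X \<xi> x * (x / (t + x\<^sup>2))) =
    t * (\<Sum>x\<in>X. \<xi> x / (t + x\<^sup>2))\<^sup>2 + (\<Sum>x\<in>X. \<xi> x * x / (t + x\<^sup>2))\<^sup>2"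
proof -
  have "(x / (t + x\<^sup>2) + y / (t + y\<^sup>2)) / (x + y) =
      t * (1 / (t + x\<^sup>2)) * (1 / (t + y\<^sup>2)) + x / (t + x\<^sup>2) * (y / (t + y\<^sup>2))"
    if "x > 0" "y > 0" for x y
  proof -
    have "t + x\<^sup>2 > 0" "t + y\<^sup>2 > 0" "x + y > 0" using that \<open>t \<ge> 0\<close> by (auto intro: add_nonneg_pos)
    then show ?thesis
      by (simp add: divide_simps) (simp add: power2_eq_square algebra_simps)
  qed
  then have "(\<Sum>x\<in>X. \<Sum>y\<in>X. \<xi> x * \<xi> y * ((x / (t + x\<^sup>2) + y / (t + y\<^sup>2)) / (x + y))) =
      (\<Sum>x\<in>X. \<Sum>y\<in>X. \<xi> x * \<xi> y * (t * (1 / (t + x\<^sup>2)) * (1 / (t + y\<^sup>2)) + x / (t + x\<^sup>2) * (y / (t + y\<^sup>2))))"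
    using X(2) by (intro sum.cong refl) (auto simp: subset_iff)
  then show ?thesis
    unfolding anti_loewner_form_eq
    by (simp add: power2_eq_square[of "sum _ _"] sum_product sum_distrib_left algebra_simps sum.distrib)
qed

text \<open>For the identity function every matrix entry is 1.\<close>

lemma loewner_coeff_sum_id:
  assumes X: "finite X" "X \<subseteq> {0<..}"
  shows "(\<Sum>x\<in>X. loewner_coeff X \<xi> x * x) = (\<Sum>x\<in>X. \<xi> x)\<^sup>2"
proof -
  have "(\<Sum>x\<in>X. loewner_coeff X \<xi> x * x) = (\<Sum>x\<in>X. \<Sum>y\<in>X. \<xi> x * \<xi> y * ((x + y) / (x + y)))"
    by (rule anti_loewner_form_eq[symmetric])
  also have "\<dots> = (\<Sum>x\<in>X. \<Sum>y\<in>X. \<xi> x * \<xi> y)"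
    using X(2) by (intro sum.cong refl) (auto simp: subset_iff add_pos_pos less_imp_neq[THEN not_sym])
  finally show ?thesis by (simp add: power2_eq_square sum_product)
qed

subsection \<open>Functionals nonnegative on all kernels\<close>

text \<open>The differences are written \<open>y - z\<close> so that \<open>z = - x\<close> later
  produces the factors \<open>y + x\<close>.\<close>

lemma lagrange_interpolation:
  fixes r :: "real poly"
  assumes X: "finite X" and deg: "degree r < card X"
  shows "poly r z = (\<Sum>x\<in>X. poly r x / (\<Prod>y\<in>X - {x}. y - x) * (\<Prod>y\<in>X - {x}. y - z))"
proof -
  define l where "l x = (\<Prod>y\<in>X - {x}. [:y, -1:])" for x
  define s where "s = (\<Sum>x\<in>X. Polynomial.smult (poly r x / (\<Prod>y\<in>X - {x}. y - x)) (l x))"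
  have poly_l: "poly (l x) z = (\<Prod>y\<in>X - {x}. y - z)" for x z
    by (simp add: l_def poly_prod)
  have "degree (l x) < card X" if "x \<in> X" for x
  proof -
    have "degree (l x) \<le> (\<Sum>y\<in>X - {x}. degree [:y, -1:])"
      unfolding l_def by (rule order_trans[OF degree_prod_sum_le]) (use X in \<open>auto simp: o_def\<close>)
    also have "\<dots> = card X - 1" using X that by simp
    finally show ?thesis using deg by linarith
  qed
  then have deg_s: "degree s < card X"
    unfolding s_def using deg by (intro degree_sum_less le_less_trans[OF degree_smult_le]) auto
  have "r = s"
  proof (rule poly_eqI_degree[of X])
    fix z assume z: "z \<in> X"
    have "poly s z = (\<Sum>x\<in>X. if x = z then poly r z else 0)"
      unfolding s_def poly_sum
    proof (rule sum.cong)
      fix x assume "x \<in> X"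
      show "poly (Polynomial.smult (poly r x / (\<Prod>y\<in>X - {x}. y - x)) (l x)) z = (if x = z then poly r z else 0)"
      proof (cases "x = z")
        case False
        then have "poly (l x) z = 0" using X z by (auto simp: poly_l prod_zero_iff)
        then show ?thesis using False by simp
      qed (use X in \<open>auto simp: poly_l prod_zero_iff\<close>)
    qed simp
    also have "\<dots> = poly r z" using X z by simp
    finally show "poly r z = poly s z" ..
  qed (use deg deg_s in auto)
  then have "poly r z = poly s z" by simp
  also have "\<dots> = (\<Sum>x\<in>X. poly r x / (\<Prod>y\<in>X - {x}. y - x) * (\<Prod>y\<in>X - {x}. y - z))"
    by (simp add: s_def poly_sum poly_l)
  finally show ?thesis .
qed

text \<open>The converse of positivity on kernels: a functional nonnegative on all of them is a
  quadratic form on the same points. The vector \<open>\<xi>\<close> consists of the Lagrange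
  coefficients of the factor \<open>r\<close> of the cleared numerator \<open>p\<close>.\<close>

lemma nonneg_on_kernels_imp_loewner_coeff:
  assumes X: "finite X" "X \<subseteq> {0<..}"
    and nonneg: "\<And>t. t \<ge> 0 \<Longrightarrow> 0 \<le> (\<Sum>x\<in>X. c x * (x / (t + x\<^sup>2)))"
  obtains \<xi> where "\<And>x. x \<in> X \<Longrightarrow> c x = loewner_coeff X \<xi> x"
proof (cases "X = {}")
  case False
  define l where "l x = (\<Prod>y\<in>X - {x}. [:y\<^sup>2, 1:])" for x
  define p where "p = (\<Sum>x\<in>X. Polynomial.smult (c x * x) (l x))"
  have poly_l: "poly (l x) t = (\<Prod>y\<in>X - {x}. t + y\<^sup>2)" for x t
    by (simp add: l_def poly_prod add.commute)
  have poly_p: "poly p t = (\<Sum>x\<in>X. c x * x * (\<Prod>y\<in>X - {x}. t + y\<^sup>2))" for t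
    by (simp add: p_def poly_sum poly_l)
  have "degree (l x) < card X" if "x \<in> X" for x
  proof -
    have "degree (l x) \<le> (\<Sum>y\<in>X - {x}. degree [:y\<^sup>2, 1:])"
      unfolding l_def by (rule order_trans[OF degree_prod_sum_le]) (use X in \<open>auto simp: o_def\<close>)
    also have "\<dots> = card X - 1" using X that by simp
    finally show ?thesis using X(1) False by (meson card_gt_0_iff diff_less le_less_trans less_one)
  qed
  moreover have "0 < card X" using X(1) False by (simp add: card_gt_0_iff)
  ultimately have deg_p: "degree p < card X"
    unfolding p_def by (intro degree_sum_less le_less_trans[OF degree_smult_le])
  have "poly p t \<ge> 0" if "t \<ge> 0" for t
  proof -
    have pos: "t + x\<^sup>2 > 0" if "x \<in> X" for x
      using that X(2) \<open>t \<ge> 0\<close> by (auto intro!: add_nonneg_pos)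
    have "c x * x * (\<Prod>y\<in>X - {x}. t + y\<^sup>2) = c x * (x / (t + x\<^sup>2)) * (\<Prod>y\<in>X. t + y\<^sup>2)" if "x \<in> X" for x
      using pos[OF that] by (simp add: prod.remove[OF X(1) that])
    then have "poly p t = (\<Sum>x\<in>X. c x * (x / (t + x\<^sup>2))) * (\<Prod>y\<in>X. t + y\<^sup>2)"
      by (simp add: poly_p sum_distrib_right)
    then show ?thesis
      using nonneg[OF that] pos prod_nonneg[of X "\<lambda>y. t + y\<^sup>2"] by (simp add: less_imp_le)
  qed
  then obtain r where r: "degree r \<le> degree p" "\<And>z. poly r z * poly r (-z) = poly p (-(z\<^sup>2))"
    using poly_nonneg_imp_reflection_product by blast
  define \<xi> where "\<xi> x = poly r x / (\<Prod>y\<in>X - {x}. y - x)" for x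
  have interp: "poly r z = (\<Sum>x\<in>X. \<xi> x * (\<Prod>y\<in>X - {x}. y - z))" for z
    unfolding \<xi>_def by (rule lagrange_interpolation) (use X r(1) deg_p in auto)
  have "c x = loewner_coeff X \<xi> x" if x: "x \<in> X" for x
  proof -
    have "x > 0" using x X(2) by auto
    have nz: "(\<Prod>y\<in>X - {x}. y - x) \<noteq> 0" "(\<Prod>y\<in>X - {x}. y + x) \<noteq> 0"
      using X \<open>x > 0\<close> by (auto simp: prod_zero_iff)
    have "poly r (- x) = (\<Sum>y\<in>X. \<xi> y / (x + y)) * (\<Prod>y\<in>X. y + x)"
    proof -
      have "\<xi> y * (\<Prod>z\<in>X - {y}. z + x) = \<xi> y / (x + y) * (\<Prod>z\<in>X. z + x)" if "y \<in> X" for y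
        using that X(2) \<open>x > 0\<close> by (auto simp: prod.remove[OF X(1) that] subset_iff add_pos_pos
            add.commute[of x] less_imp_neq[THEN not_sym])
      then show ?thesis by (simp add: interp sum_distrib_right)
    qed
    \<comment> \<open>The factor for \<open>y = x\<close> supplies the 2 in
      \<open>loewner_coeff\<close>.\<close>
    also have "(\<Prod>y\<in>X. y + x) = 2 * x * (\<Prod>y\<in>X - {x}. y + x)"
      by (simp add: prod.remove[OF X(1) x])
    finally have r_minus: "poly r (- x) = (\<Sum>y\<in>X. \<xi> y / (x + y)) * (2 * x * (\<Prod>y\<in>X - {x}. y + x))" .
    have r_plus: "poly r x = \<xi> x * (\<Prod>y\<in>X - {x}. y - x)"
      using nz by (simp add: \<xi>_def)
    \<comment> \<open>Evaluation at \<open>-(x^2)\<close> isolates \<open>c x\<close>, because every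
      other summand contains the factor \<open>-(x^2) + x^2\<close>.\<close>
    have "poly p (-(x\<^sup>2)) = (\<Sum>z\<in>X. if z = x then c x * x * (\<Prod>y\<in>X - {x}. - (x\<^sup>2) + y\<^sup>2) else 0)"
      unfolding poly_p using X(1) x by (intro sum.cong refl) (auto simp: prod_zero_iff)
    also have "\<dots> = c x * x * (\<Prod>y\<in>X - {x}. (y - x) * (y + x))"
      using X(1) x by (simp add: power2_eq_square algebra_simps)
    finally have "c x * x * ((\<Prod>y\<in>X - {x}. y - x) * (\<Prod>y\<in>X - {x}. y + x)) = poly r x * poly r (- x)"
      by (simp add: prod.distrib r(2))
    also have "\<dots> = loewner_coeff X \<xi> x * x * ((\<Prod>y\<in>X - {x}. y - x) * (\<Prod>y\<in>X - {x}. y + x))"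
      unfolding r_plus r_minus loewner_coeff_def by (simp add: algebra_simps)
    finally show ?thesis using nz \<open>x > 0\<close> by simp
  qed
  then show ?thesis by (rule that)
qed (use that in auto)

subsection \<open>Interpolation at finitely many points\<close>

text \<open>Probability measures on \<open>[0, 1]\<close>, kept as measures on the whole line so
  that Helly selection for real distributions applies.\<close>

definition unit_distribution :: "real measure \<Rightarrow> bool" where
  "unit_distribution M \<longleftrightarrow> real_distribution M \<and> (AE u in M. u \<in> {0..1})"

section \<open>Weak compactness of the probability measures on \<open>[0, 1]\<close>\<close>

lemma unit_distribution_integrable:
  fixes f :: "real \<Rightarrow> real"
  assumes M: "unit_distribution M" and f: "f \<in> borel_measurable borel" "continuous_on {0..1} f"
  shows "integrable M f"
proof -
  interpret real_distribution M using M by (simp add: unit_distribution_def)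
  have "compact (f ` {0..1})" using f(2) by (intro compact_continuous_image) auto
  then obtain B where "\<And>u. u \<in> {0..1} \<Longrightarrow> norm (f u) \<le> B"
    by (meson bounded_iff compact_imp_bounded imageI)
  moreover have "AE u in M. u \<in> {0..1}" using M by (simp add: unit_distribution_def)
  ultimately have "AE u in M. norm (f u) \<le> B"
    by (metis (mono_tags, lifting) eventually_mono)
  then show ?thesis
    using f(1) by (intro integrable_const_bound[of _ B]) simp_all
qed

lemma unit_distributions_compact:
  fixes M :: "nat \<Rightarrow> real measure"
  assumes M: "\<And>n. unit_distribution (M n)"
  obtains s M' where "strict_mono (s :: nat \<Rightarrow> nat)" "unit_distribution M'"
    "\<And>f :: real \<Rightarrow> real. f \<in> borel_measurable borel \<Longrightarrow> continuous_on {0..1} f \<Longrightarrow>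
       (\<lambda>n. \<integral>u. f u \<partial>M (s n)) \<longlonglongrightarrow> (\<integral>u. f u \<partial>M')"
proof -
  have rd: "real_distribution (M n)" and AE: "AE u in M n. u \<in> {0..1}" for n
    using M[of n] by (auto simp: unit_distribution_def)
  have "tight M"
    unfolding tight_def
  proof (intro conjI allI impI)
    fix \<epsilon> :: real assume "\<epsilon> > 0"
    \<comment> \<open>Tightness uses left-open intervals, so the left end lies below 0 to include a
      possible atom there.\<close>
    have "measure (M n) {-1<..1} = 1" for n
    proof -
      interpret real_distribution "M n" by (rule rd)
      show ?thesis using AE[of n] by (subst prob_eq_1) auto
    qed
    with \<open>\<epsilon> > 0\<close> show "\<exists>a b. a < b \<and> (\<forall>n. 1 - \<epsilon> < measure (M n) {a<..b})"
      by (intro exI[of _ "-1"] exI[of _ "1"]) simp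
  qed (rule rd)
  then obtain s M0 where s: "strict_mono s" and M0: "real_distribution M0"
    and conv: "weak_conv_m (M \<circ> id \<circ> s) M0"
    using tight_imp_convergent_subsubsequence[of M id] strict_mono_id by blast
  interpret M0: real_distribution M0 by (rule M0)
  \<comment> \<open>Composing with \<open>clamp\<close> makes \<open>f\<close> bounded and
    continuous on the line without changing its integrals under \<open>M n\<close>. Pushing the
    limit forward along \<open>clamp\<close> places it on \<open>[0, 1]\<close>.\<close>
  define clamp :: "real \<Rightarrow> real" where "clamp u = max 0 (min 1 u)" for u
  have clamp_meas [measurable]: "clamp \<in> borel_measurable borel"
    unfolding clamp_def by measurable
  define M' where "M' = distr M0 borel clamp"
  show ?thesis
  proof (rule that[OF s])
    show "unit_distribution M'"
      unfolding unit_distribution_def M'_def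
      by (auto simp: AE_distr_iff clamp_def)
    fix f :: "real \<Rightarrow> real"
    assume f [measurable]: "f \<in> borel_measurable borel" and cont: "continuous_on {0..1} f"
    have "compact (f ` {0..1})" using cont by (intro compact_continuous_image) auto
    then obtain B where B: "\<And>u. u \<in> {0..1} \<Longrightarrow> norm (f u) \<le> B"
      by (meson bounded_iff compact_imp_bounded imageI)
    have "(\<lambda>n. \<integral>u. f (clamp u) \<partial>(M \<circ> id \<circ> s) n) \<longlonglongrightarrow> (\<integral>u. f (clamp u) \<partial>M0)"
    proof (rule weak_conv_imp_integral_bdd_continuous_conv)
      show "norm (f (clamp u)) \<le> B" for u by (rule B) (auto simp: clamp_def)
      have "continuous_on UNIV (\<lambda>u. f (clamp u))"
        by (rule continuous_on_compose2[OF cont]) (auto simp: clamp_def intro!: continuous_intros)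
      then show "isCont (\<lambda>u. f (clamp u)) u" for u
        by (simp add: continuous_on_eq_continuous_at)
    qed (use rd M0 conv in \<open>auto simp: o_def\<close>)
    moreover have "(\<integral>u. f (clamp u) \<partial>M (s n)) = (\<integral>u. f u \<partial>M (s n))" for n
    proof (rule integral_cong_AE)
      interpret real_distribution "M (s n)" by (rule rd)
      show "(\<lambda>u. f (clamp u)) \<in> borel_measurable (M (s n))" "f \<in> borel_measurable (M (s n))"
        by measurable
      show "AE u in M (s n). f (clamp u) = f u"
        using AE[of "s n"] by eventually_elim (auto simp: clamp_def)
    qed
    ultimately show "(\<lambda>n. \<integral>u. f u \<partial>M (s n)) \<longlonglongrightarrow> (\<integral>u. f u \<partial>M')"
      by (simp add: M'_def integral_distr)
  qed
qed

text \<open>With \<open>u = t / (1 + t)\<close> this is \<open>(1 + t) x / (t + x\<^sup>2)\<close>; the endpoints \<open>u = 0\<close> and \<open>u = 1\<close> are \<open>1 / x\<close>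
  and \<open>x\<close>.\<close>

definition loewner_kernel :: "real \<Rightarrow> real \<Rightarrow> real" where
  "loewner_kernel x u = x / (u + (1 - u) * x\<^sup>2)"

lemma loewner_kernel_measurable [measurable]: "loewner_kernel x \<in> borel_measurable borel"
  unfolding loewner_kernel_def by measurable

lemma loewner_kernel_denom_pos:
  fixes x u :: real
  assumes "x > 0" "u \<in> {0..1}"
  shows "0 < u + (1 - u) * x\<^sup>2"
proof (cases "u = 0")
  case False
  with assms have "0 < u" "0 \<le> (1 - u) * x\<^sup>2" by auto
  then show ?thesis by (rule add_pos_nonneg)
qed (use assms in simp)

lemma loewner_kernel_continuous: "x > 0 \<Longrightarrow> continuous_on {0..1} (loewner_kernel x)"
  unfolding loewner_kernel_def
  by (intro continuous_intros) (use loewner_kernel_denom_pos in fastforce)+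

lemma loewner_kernel_one [simp]: "loewner_kernel 1 u = 1"
  by (simp add: loewner_kernel_def)

text \<open>Divide by \<open>2 * \<epsilon>\<close> and let \<open>\<epsilon>\<close> tend to 0. The
  bound \<open>\<epsilon> < 1\<close> lets \<open>\<epsilon>\<close> serve as a mixing
  weight.\<close>

lemma quadratic_min_first_order:
  fixes a b :: real
  assumes "\<And>\<epsilon>. 0 < \<epsilon> \<Longrightarrow> \<epsilon> < 1 \<Longrightarrow> 0 \<le> 2 * \<epsilon> * a + \<epsilon>\<^sup>2 * b"
  shows "0 \<le> a"
proof (rule tendsto_lowerbound)
  show "((\<lambda>\<epsilon>. a + \<epsilon> * b / 2) \<longlongrightarrow> a) (at_right 0)"
    by (rule tendsto_eq_intros refl | simp)+
  have "0 \<le> a + \<epsilon> * b / 2" if "0 < \<epsilon>" "\<epsilon> < 1" for \<epsilon>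
  proof -
    have "2 * \<epsilon> * a + \<epsilon>\<^sup>2 * b = 2 * \<epsilon> * (a + \<epsilon> * b / 2)"
      by (simp add: power2_eq_square algebra_simps)
    then show ?thesis using assms[OF that] that by (simp add: zero_le_mult_iff)
  qed
  then show "\<forall>\<^sub>F \<epsilon> in at_right 0. 0 \<le> a + \<epsilon> * b / 2"
    by (auto simp: eventually_at_right_field intro!: exI[of _ 1])
qed simp

lemma finite_interpolation:
  assumes X: "finite X" "X \<subseteq> {0<..}" "1 \<in> X" and "g 1 = 1"
    and nonneg: "\<And>\<xi>. 0 \<le> (\<Sum>x\<in>X. loewner_coeff X \<xi> x * g x)"
  shows "\<exists>M. unit_distribution M \<and> (\<forall>x\<in>X. (\<integral>u. loewner_kernel x u \<partial>M) = g x)"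
proof -
  \<comment> \<open>Finitely supported laws are closed under mixing with a point mass and have
    finite sums as expectations. The infimum is attained by a weak limit \<open>M\<close>, which may
    lie outside \<open>P\<close>.\<close>
  define P where "P = {p :: real pmf. finite (set_pmf p) \<and> set_pmf p \<subseteq> {0..1}}"
  define E where "E p x = measure_pmf.expectation p (loewner_kernel x)" for p x
  define F where "F p = (\<Sum>x\<in>X. (E p x - g x)\<^sup>2)" for p
  define I where "I = Inf (F ` P)"
  have "return_pmf 0 \<in> P" by (simp add: P_def)
  then have ne: "F ` P \<noteq> {}" by blast
  have bdd: "bdd_below (F ` P)"
    by (intro bdd_belowI[of _ 0]) (auto simp: F_def sum_nonneg)
  have "\<exists>p\<in>P. F p < I + 1 / Suc n" for n
    using cInf_lessD[OF ne, of "I + 1 / Suc n"] by (auto simp: I_def)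
  then obtain p where p: "\<And>n. p n \<in> P" "\<And>n. F (p n) < I + 1 / Suc n"
    by metis
  have "unit_distribution (distr (measure_pmf (p n)) borel (\<lambda>u. u))" for n
    using p(1)[of n] unfolding unit_distribution_def
    by (auto simp: P_def AE_distr_iff AE_measure_pmf_iff intro!: prob_space.real_distribution_distr measure_pmf.prob_space_axioms)
  then obtain s M where s: "strict_mono s" and M: "unit_distribution M"
    and lim: "\<And>f :: real \<Rightarrow> real. f \<in> borel_measurable borel \<Longrightarrow> continuous_on {0..1} f \<Longrightarrow>
       (\<lambda>n. \<integral>u. f u \<partial>distr (measure_pmf (p (s n))) borel (\<lambda>u. u)) \<longlonglongrightarrow> (\<integral>u. f u \<partial>M)"
    using unit_distributions_compact[of "\<lambda>n. distr (measure_pmf (p n)) borel (\<lambda>u. u)"] by blast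
  define m where "m x = (\<integral>u. loewner_kernel x u \<partial>M)" for x
  have E_lim: "(\<lambda>n. E (p (s n)) x) \<longlonglongrightarrow> m x" if "x \<in> X" for x
    using lim[of "loewner_kernel x"] loewner_kernel_continuous[of x] that X(2)
    by (auto simp: E_def m_def integral_distr)
  define c where "c x = m x - g x" for x
  have "(\<lambda>n. F (p (s n))) \<longlonglongrightarrow> (\<Sum>x\<in>X. (c x)\<^sup>2)"
    unfolding F_def c_def by (intro tendsto_intros E_lim)
  moreover have "(\<lambda>n. F (p (s n))) \<longlonglongrightarrow> I"
  proof (rule tendsto_sandwich)
    show "\<forall>\<^sub>F n in sequentially. I \<le> F (p (s n))"
      unfolding I_def using p(1) bdd by (intro always_eventually allI cInf_lower) auto
    show "\<forall>\<^sub>F n in sequentially. F (p (s n)) \<le> I + 1 / Suc (s n)"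
      using p(2) by (auto intro!: always_eventually less_imp_le)
    have "(\<lambda>n. I + 1 / Suc n) \<longlonglongrightarrow> I + 0"
      by (intro tendsto_intros LIMSEQ_Suc[OF lim_1_over_n])
    then show "(\<lambda>n. I + 1 / Suc (s n)) \<longlonglongrightarrow> I"
      using LIMSEQ_subseq_LIMSEQ[OF _ s] by (fastforce simp: o_def)
  qed simp
  ultimately have I_eq: "I = (\<Sum>x\<in>X. (c x)\<^sup>2)"
    by (rule LIMSEQ_unique[rotated])
  have m_one: "m 1 = 1"
    using M by (simp add: m_def unit_distribution_def real_distribution_def prob_space.prob_space)
  \<comment> \<open>The near-minimisers are perturbed instead of \<open>M\<close>: moving mass
    \<open>\<epsilon>\<close> to \<open>u\<close> stays in \<open>P\<close>, and the limit in
    \<open>n\<close> gives the variational inequality.\<close>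
  have var: "0 \<le> (\<Sum>x\<in>X. c x * (loewner_kernel x u - m x))" if u: "u \<in> {0..1}" for u
  proof (rule quadratic_min_first_order)
    fix \<epsilon> :: real assume \<epsilon>: "0 < \<epsilon>" "\<epsilon> < 1"
    define q where "q n = bind_pmf (bernoulli_pmf \<epsilon>) (\<lambda>b. if b then return_pmf u else p (s n))" for n
    have fin: "finite (set_pmf (p n))" for n using p(1)[of n] by (simp add: P_def)
    have "q n \<in> P" for n
      using p(1)[of "s n"] u \<epsilon> by (auto simp: P_def q_def set_pmf_bernoulli split: if_splits)
    then have I_le: "I \<le> F (q n)" for n
      unfolding I_def using bdd by (intro cInf_lower) auto
    have "E (q n) x = \<epsilon> * loewner_kernel x u + (1 - \<epsilon>) * E (p (s n)) x" for n x
      unfolding E_def q_def using \<epsilon> fin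
      by (subst pmf_expectation_bind[of UNIV]) (auto simp: UNIV_bool)
    then have "(\<lambda>n. F (q n)) \<longlonglongrightarrow>
        (\<Sum>x\<in>X. (\<epsilon> * loewner_kernel x u + (1 - \<epsilon>) * m x - g x)\<^sup>2)"
      unfolding F_def by (simp only:) (intro tendsto_intros E_lim)
    then have "I \<le> (\<Sum>x\<in>X. (\<epsilon> * loewner_kernel x u + (1 - \<epsilon>) * m x - g x)\<^sup>2)"
      using I_le by (intro LIMSEQ_le_const) auto
    also have "\<dots> = I + 2 * \<epsilon> * (\<Sum>x\<in>X. c x * (loewner_kernel x u - m x))
        + \<epsilon>\<^sup>2 * (\<Sum>x\<in>X. (loewner_kernel x u - m x)\<^sup>2)"
      unfolding I_eq c_def
      by (simp add: sum_distrib_left power2_eq_square algebra_simps flip: sum.distrib)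
    finally show "0 \<le> 2 * \<epsilon> * (\<Sum>x\<in>X. c x * (loewner_kernel x u - m x))
        + \<epsilon>\<^sup>2 * (\<Sum>x\<in>X. (loewner_kernel x u - m x)\<^sup>2)" by simp
  qed
  \<comment> \<open>The kernel is constantly 1 at \<open>x = 1\<close>, so changing the coefficient there shifts the functional by a
    constant.\<close>
  define B where "B = (\<Sum>x\<in>X. c x * m x)"
  define d where "d x = c x - (if x = 1 then B else 0)" for x
  have d_sum: "(\<Sum>x\<in>X. d x * h x) = (\<Sum>x\<in>X. c x * h x) - B * h 1" for h
  proof -
    have "(\<Sum>x\<in>X. d x * h x) = (\<Sum>x\<in>X. c x * h x - (if x = 1 then B * h 1 else 0))"
      by (intro sum.cong) (auto simp: d_def algebra_simps)
    then show ?thesis using X by (simp add: sum_subtractf)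
  qed
  have "0 \<le> (\<Sum>x\<in>X. d x * (x / (t + x\<^sup>2)))" if "t \<ge> 0" for t
  proof -
    have kernel: "x / (t + x\<^sup>2) = loewner_kernel x (t / (1 + t)) / (1 + t)" if "x \<in> X" for x
    proof -
      have "t / (1 + t) + (1 - t / (1 + t)) * x\<^sup>2 = (t + x\<^sup>2) / (1 + t)"
        using \<open>t \<ge> 0\<close> by (simp add: divide_simps)
      then show ?thesis using \<open>t \<ge> 0\<close> by (simp add: loewner_kernel_def)
    qed
    have "0 \<le> (\<Sum>x\<in>X. d x * loewner_kernel x (t / (1 + t)))"
      using var[of "t / (1 + t)"] \<open>t \<ge> 0\<close> unfolding d_sum
      by (simp add: B_def algebra_simps sum_subtractf)
    then have "0 \<le> (\<Sum>x\<in>X. d x * loewner_kernel x (t / (1 + t))) / (1 + t)"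
      using \<open>t \<ge> 0\<close> by simp
    also have "\<dots> = (\<Sum>x\<in>X. d x * (x / (t + x\<^sup>2)))"
      by (simp add: kernel sum_divide_distrib)
    finally show ?thesis .
  qed
  then obtain \<xi> where \<xi>: "\<And>x. x \<in> X \<Longrightarrow> d x = loewner_coeff X \<xi> x"
    using nonneg_on_kernels_imp_loewner_coeff[OF X(1,2), of d] by blast
  have "0 \<le> (\<Sum>x\<in>X. d x * g x)"
    using nonneg[of \<xi>] \<xi> by simp
  \<comment> \<open>As \<open>g 1 = 1\<close>, the shift by \<open>B\<close> turns the sum of
    \<open>c x * g x\<close> into that of \<open>c x * (g x - m x)\<close>.\<close>
  also have "\<dots> = - (\<Sum>x\<in>X. (c x)\<^sup>2)"
    unfolding d_sum \<open>g 1 = 1\<close> B_def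
    by (simp add: c_def power2_eq_square algebra_simps flip: sum_subtractf sum_negf)
  finally have "(\<Sum>x\<in>X. (c x)\<^sup>2) = 0"
    using sum_nonneg[of X "\<lambda>x. (c x)\<^sup>2"] by simp
  then have "\<forall>x\<in>X. c x = 0"
    using X(1) by (simp add: sum_nonneg_eq_0_iff)
  then show ?thesis
    using M by (auto simp: c_def m_def)
qed

subsection \<open>The integral representation\<close>

lemma quadratic_form_nonneg_imp_discriminant:
  fixes P Q R :: real
  assumes nonneg: "\<And>a b. 0 \<le> P * a\<^sup>2 + 2 * Q * a * b + R * b\<^sup>2"
  shows "Q\<^sup>2 \<le> P * R"
proof (cases "R = 0")
  case True
  have "Q = 0"
  proof (rule ccontr)
    assume "Q \<noteq> 0"
    then show False
      \<comment> \<open>With \<open>R = 0\<close> the form takes the value -1 here.\<close>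
      using nonneg[of 1 "- (P + 1) / (2 * Q)"] True by (simp add: field_simps)
  qed
  with True show ?thesis by simp
next
  case False
  then have "R > 0" using nonneg[of 0 1] by simp
  have "0 \<le> R * (P * R - Q\<^sup>2)"
    using nonneg[of R "- Q"] by (simp add: power2_eq_square algebra_simps)
  then show ?thesis using \<open>R > 0\<close> by (simp add: zero_le_mult_iff)
qed

lemma anti_loewner_nonneg:
  assumes "anti_loewner g" "x > 0"
  shows "0 \<le> g x"
proof -
  have "0 \<le> (\<Sum>x\<in>{x}. loewner_coeff {x} (\<lambda>_. 1) x * g x)"
    using assms(1)[unfolded anti_loewner_iff, rule_format, of "{x}" "\<lambda>_. 1"] assms(2) by simp
  then show ?thesis using assms(2) by (simp add: loewner_coeff_def zero_le_divide_iff)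
qed

text \<open>The determinant of the two-point matrix gives
  \<open>(x g(x) - y g(y)) (y g(x) - x g(y)) \<le> 0\<close>. As \<open>g \<ge> 0\<close> and
  \<open>x \<le> y\<close>, failure of either bound would make both factors strictly of the same
  sign.\<close>

lemma anti_loewner_growth:
  assumes g: "anti_loewner g" and "0 < x" "x \<le> y"
  shows "x * g x \<le> y * g y" "x * g y \<le> y * g x"
proof -
  have "x * g x \<le> y * g y \<and> x * g y \<le> y * g x"
  proof (cases "x = y")
    case False
    then have "x < y" "0 < y" using assms by auto
    have gx: "0 \<le> g x" and gy: "0 \<le> g y"
      using anti_loewner_nonneg[OF g] \<open>0 < x\<close> \<open>0 < y\<close> by auto
    have "0 \<le> g x / x * a\<^sup>2 + 2 * ((g x + g y) / (x + y)) * a * b + g y / y * b\<^sup>2" for a b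
    proof -
      define \<xi> where "\<xi> z = (if z = x then a else b)" for z
      have "0 \<le> (\<Sum>z\<in>{x, y}. loewner_coeff {x, y} \<xi> z * g z)"
        using g \<open>0 < x\<close> \<open>0 < y\<close> by (simp only: anti_loewner_iff) auto
      also have "\<dots> = (\<Sum>z\<in>{x, y}. \<Sum>w\<in>{x, y}. \<xi> z * \<xi> w * ((g z + g w) / (z + w)))"
        by (rule anti_loewner_form_eq[symmetric])
      also have "\<dots> = g x / x * a\<^sup>2 + 2 * ((g x + g y) / (x + y)) * a * b + g y / y * b\<^sup>2"
        using \<open>x < y\<close> by (simp add: \<xi>_def add.commute power2_eq_square algebra_simps)
      finally show ?thesis .
    qed
    then have "((g x + g y) / (x + y))\<^sup>2 \<le> g x / x * (g y / y)"
      by (rule quadratic_form_nonneg_imp_discriminant)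
    then have "x * y * (g x + g y)\<^sup>2 \<le> g x * g y * (x + y)\<^sup>2"
      using \<open>0 < x\<close> \<open>0 < y\<close> by (simp add: power_divide divide_simps mult_ac)
    then have prod: "(x * g x - y * g y) * (y * g x - x * g y) \<le> 0"
      by (simp add: power2_eq_square algebra_simps)
    have xy: "x * g x \<le> y * g x" "x * g y \<le> y * g y"
      using \<open>x < y\<close> gx gy by (auto intro: mult_right_mono)
    have "x * g x \<le> y * g y"
    proof (rule ccontr)
      assume "\<not> ?thesis"
      then have "0 < (x * g x - y * g y) * (y * g x - x * g y)"
        using xy by (intro mult_pos_pos) auto
      with prod show False by simp
    qed
    moreover have "x * g y \<le> y * g x"
    proof (rule ccontr)
      assume "\<not> ?thesis"
      then have "0 < (x * g x - y * g y) * (y * g x - x * g y)"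
        using xy by (intro mult_neg_neg) auto
      with prod show False by simp
    qed
    ultimately show ?thesis ..
  qed simp
  then show "x * g x \<le> y * g y" "x * g y \<le> y * g x" by auto
qed

text \<open>A squeeze between \<open>x * f x / y n\<close> and \<open>y n * f x / x\<close>. It
  serves both \<open>g\<close> and the integral of the kernel.\<close>

lemma growth_imp_tendsto:
  fixes f :: "real \<Rightarrow> real"
  assumes growth: "\<And>y. x \<le> y \<Longrightarrow> x * f x \<le> y * f y" "\<And>y. x \<le> y \<Longrightarrow> x * f y \<le> y * f x"
    and "x > 0" and y: "y \<longlonglongrightarrow> x" "\<And>n. x \<le> y n"
  shows "(\<lambda>n. f (y n)) \<longlonglongrightarrow> f x"
proof (rule tendsto_sandwich)
  have "(\<lambda>n. x * f x / y n) \<longlonglongrightarrow> x * f x / x" "(\<lambda>n. y n * f x / x) \<longlonglongrightarrow> x * f x / x"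
    using \<open>x > 0\<close> by (intro tendsto_intros y; simp)+
  then show "(\<lambda>n. x * f x / y n) \<longlonglongrightarrow> f x" "(\<lambda>n. y n * f x / x) \<longlonglongrightarrow> f x"
    using \<open>x > 0\<close> by auto
  have "y n > 0" for n using y(2)[of n] \<open>x > 0\<close> by linarith
  then show "\<forall>\<^sub>F n in sequentially. x * f x / y n \<le> f (y n)"
    "\<forall>\<^sub>F n in sequentially. f (y n) \<le> y n * f x / x"
    using growth[OF y(2)] \<open>x > 0\<close> by (auto simp: field_simps intro!: always_eventually)
qed

text \<open>Kernels obey the growth bounds of \<open>g\<close>; integrated, these make the
  represented function continuous from the right.\<close>

lemma loewner_kernel_growth:
  assumes "0 < x" "x \<le> y" "u \<in> {0..1}"
  shows "x * loewner_kernel x u \<le> y * loewner_kernel y u" "x * loewner_kernel y u \<le> y * loewner_kernel x u"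
proof -
  have "0 < y" using assms by linarith
  have D: "0 < u + (1 - u) * x\<^sup>2" "0 < u + (1 - u) * y\<^sup>2"
    using loewner_kernel_denom_pos assms \<open>0 < y\<close> by auto
  have sq: "x\<^sup>2 \<le> y\<^sup>2" using assms by (intro power_mono) auto
  have "x\<^sup>2 * u \<le> y\<^sup>2 * u"
    using assms sq by (intro mult_right_mono) auto
  then have "x\<^sup>2 * (u + (1 - u) * y\<^sup>2) \<le> y\<^sup>2 * (u + (1 - u) * x\<^sup>2)"
    by (simp add: algebra_simps)
  then have "x\<^sup>2 / (u + (1 - u) * x\<^sup>2) \<le> y\<^sup>2 / (u + (1 - u) * y\<^sup>2)"
    using D by (simp add: divide_simps)
  then show "x * loewner_kernel x u \<le> y * loewner_kernel y u"
    by (simp add: loewner_kernel_def power2_eq_square)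
  have "u + (1 - u) * x\<^sup>2 \<le> u + (1 - u) * y\<^sup>2"
    using assms sq by (intro add_left_mono mult_left_mono) auto
  then have "x * y / (u + (1 - u) * y\<^sup>2) \<le> x * y / (u + (1 - u) * x\<^sup>2)"
    using D \<open>0 < x\<close> \<open>0 < y\<close> by (intro divide_left_mono) auto
  then show "x * loewner_kernel y u \<le> y * loewner_kernel x u"
    by (simp add: loewner_kernel_def mult.commute)
qed

lemma loewner_kernel_integral_growth:
  assumes M: "unit_distribution M" and "0 < x" "x \<le> y"
  shows "x * (\<integral>u. loewner_kernel x u \<partial>M) \<le> y * (\<integral>u. loewner_kernel y u \<partial>M)"
    and "x * (\<integral>u. loewner_kernel y u \<partial>M) \<le> y * (\<integral>u. loewner_kernel x u \<partial>M)"
proof -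
  have "0 < y" using assms by linarith
  have int: "integrable M (loewner_kernel z)" if "z > 0" for z
    using M that by (intro unit_distribution_integrable loewner_kernel_continuous) auto
  have AE: "AE u in M. u \<in> {0..1}" using M by (simp add: unit_distribution_def)
  have "(\<integral>u. x * loewner_kernel x u \<partial>M) \<le> (\<integral>u. y * loewner_kernel y u \<partial>M)"
  proof (intro integral_mono_AE integrable_mult_right int \<open>0 < x\<close> \<open>0 < y\<close>)
    show "AE u in M. x * loewner_kernel x u \<le> y * loewner_kernel y u"
      using AE by eventually_elim (rule loewner_kernel_growth(1)[OF assms(2,3)])
  qed
  then show "x * (\<integral>u. loewner_kernel x u \<partial>M) \<le> y * (\<integral>u. loewner_kernel y u \<partial>M)" by simp
  have "(\<integral>u. x * loewner_kernel y u \<partial>M) \<le> (\<integral>u. y * loewner_kernel x u \<partial>M)"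
  proof (intro integral_mono_AE integrable_mult_right int \<open>0 < x\<close> \<open>0 < y\<close>)
    show "AE u in M. x * loewner_kernel y u \<le> y * loewner_kernel x u"
      using AE by eventually_elim (rule loewner_kernel_growth(2)[OF assms(2,3)])
  qed
  then show "x * (\<integral>u. loewner_kernel y u \<partial>M) \<le> y * (\<integral>u. loewner_kernel x u \<partial>M)" by simp
qed

lemma anti_loewner_unit_representation:
  assumes g: "anti_loewner g" and "g 1 = 1"
  obtains M where "unit_distribution M" "\<And>x. x > 0 \<Longrightarrow> g x = (\<integral>u. loewner_kernel x u \<partial>M)"
proof -
  define Q where "Q = {x :: real. x \<in> \<rat> \<and> x > 0}"
  have "1 \<in> Q" by (simp add: Q_def)
  have "countable Q"
    unfolding Q_def using countable_rat by (rule countable_subset[rotated]) auto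
  then obtain e :: "nat \<Rightarrow> real" where e: "range e = Q"
    using range_from_nat_into[of Q] \<open>1 \<in> Q\<close> by blast
  have "\<exists>M. unit_distribution M \<and> (\<forall>x\<in>insert 1 (e ` {..n}). (\<integral>u. loewner_kernel x u \<partial>M) = g x)" for n
  proof (rule finite_interpolation)
    have sub: "insert 1 (e ` {..n}) \<subseteq> {0<..}" using e by (auto simp: Q_def)
    then show "insert 1 (e ` {..n}) \<subseteq> {0<..}" .
    show "0 \<le> (\<Sum>x\<in>insert 1 (e ` {..n}). loewner_coeff (insert 1 (e ` {..n})) \<xi> x * g x)" for \<xi>
      by (rule g[unfolded anti_loewner_iff, rule_format, OF _ sub]) simp
  qed (use \<open>g 1 = 1\<close> in auto)
  then obtain M where M: "\<And>n. unit_distribution (M n)"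
    and interp: "\<And>n x. x \<in> insert 1 (e ` {..n}) \<Longrightarrow> (\<integral>u. loewner_kernel x u \<partial>M n) = g x"
    by metis
  obtain s M' where s: "strict_mono (s :: nat \<Rightarrow> nat)" and M': "unit_distribution M'"
    and lim: "\<And>f :: real \<Rightarrow> real. f \<in> borel_measurable borel \<Longrightarrow> continuous_on {0..1} f \<Longrightarrow>
       (\<lambda>n. \<integral>u. f u \<partial>M (s n)) \<longlonglongrightarrow> (\<integral>u. f u \<partial>M')"
    by (rule unit_distributions_compact[OF M]) (rule that; assumption)
  have rational: "g x = (\<integral>u. loewner_kernel x u \<partial>M')" if "x \<in> Q" for x
  proof -
    from that e obtain k where k: "x = e k" by auto
    \<comment> \<open>The point \<open>e k\<close> is a node of \<open>M (s n)\<close> once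
      \<open>n \<ge> k\<close>, because \<open>s n \<ge> n\<close>; the integrals are then
      constant.\<close>
    have "eventually (\<lambda>n. (\<integral>u. loewner_kernel x u \<partial>M (s n)) = g x) sequentially"
      using eventually_ge_at_top[of k]
    proof eventually_elim
      case (elim n)
      then have "k \<le> s n" using seq_suble[OF s, of n] by linarith
      then show ?case by (intro interp) (auto simp: k)
    qed
    then have "(\<lambda>n. \<integral>u. loewner_kernel x u \<partial>M (s n)) \<longlonglongrightarrow> g x"
      by (rule tendsto_eventually)
    moreover have "(\<lambda>n. \<integral>u. loewner_kernel x u \<partial>M (s n)) \<longlonglongrightarrow> (\<integral>u. loewner_kernel x u \<partial>M')"
      using that by (intro lim loewner_kernel_continuous) (auto simp: Q_def)
    ultimately show ?thesis by (rule LIMSEQ_unique)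
  qed
  show ?thesis
  proof (rule that[OF M'])
    fix x :: real assume "x > 0"
    have "\<exists>y\<in>\<rat>. x < y \<and> y < x + 1 / Suc n" for n
      by (rule Rats_dense_in_real) simp
    then obtain y where y: "\<And>n. y n \<in> \<rat>" "\<And>n. x < y n" "\<And>n. y n < x + 1 / Suc n"
      by metis
    have "y \<longlonglongrightarrow> x"
    proof (rule tendsto_sandwich[of "\<lambda>_. x" y _ "\<lambda>n. x + 1 / Suc n"])
      have "(\<lambda>n. x + 1 / Suc n) \<longlonglongrightarrow> x + 0"
        by (intro tendsto_intros LIMSEQ_Suc[OF lim_1_over_n])
      then show "(\<lambda>n. x + 1 / Suc n) \<longlonglongrightarrow> x" by simp
    qed (use y(2,3) in \<open>auto intro!: always_eventually less_imp_le\<close>)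
    have "(\<lambda>n. g (y n)) \<longlonglongrightarrow> g x"
      by (rule growth_imp_tendsto[OF _ _ \<open>x > 0\<close> \<open>y \<longlonglongrightarrow> x\<close> less_imp_le[OF y(2)]];
          rule anti_loewner_growth[OF g \<open>x > 0\<close>])
    moreover have "(\<lambda>n. \<integral>u. loewner_kernel (y n) u \<partial>M') \<longlonglongrightarrow> (\<integral>u. loewner_kernel x u \<partial>M')"
      by (rule growth_imp_tendsto[of x "\<lambda>x. \<integral>u. loewner_kernel x u \<partial>M'", OF _ _ \<open>x > 0\<close> \<open>y \<longlonglongrightarrow> x\<close> less_imp_le[OF y(2)]];
          rule loewner_kernel_integral_growth[OF M' \<open>x > 0\<close>])
    moreover have "g (y n) = (\<integral>u. loewner_kernel (y n) u \<partial>M')" for n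
      using y(1,2)[of n] \<open>x > 0\<close> by (intro rational) (simp add: Q_def)
    ultimately show "g x = (\<integral>u. loewner_kernel x u \<partial>M')"
      by (simp only: LIMSEQ_unique)
  qed
qed

section \<open>Transport from \<open>[0, 1]\<close> to the half-line, and sufficiency\<close>

lemma unit_representation_imp_half_line_representation:
  assumes M: "unit_distribution M" and "G \<ge> 0"
    and g: "\<And>x. x > 0 \<Longrightarrow> g x = G * (\<integral>u. loewner_kernel x u \<partial>M)"
  shows "\<exists>\<alpha> \<beta> (\<mu> :: real measure). \<alpha> \<ge> 0 \<and> \<beta> \<ge> 0 \<and>
       sets \<mu> = sets (restrict_space borel {0<..}) \<and>
       (\<forall>x>0. integrable \<mu> (\<lambda>t. x / (t + x\<^sup>2)) \<and>
              g x = \<alpha> / x + \<beta> * x + (\<integral>t. x / (t + x\<^sup>2) \<partial>\<mu>))"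
proof -
  interpret real_distribution M using M by (simp add: unit_distribution_def)
  have AE: "AE u in M. u \<in> {0..1}" using M by (simp add: unit_distribution_def)
  \<comment> \<open>The interior of \<open>[0, 1]\<close> is carried to the half-line by
    \<open>t = u / (1 - u)\<close>. There \<open>1 / (1 - u) = 1 + t\<close>, so the density
    \<open>G / (1 - u)\<close> cancels the normalisation of the kernel.\<close>
  define R where "R = restrict_space M {0<..<1::real}"
  define N where "N = density R (\<lambda>u. ennreal (G / (1 - u)))"
  define \<mu> where "\<mu> = distr N (restrict_space borel {0<..}) (\<lambda>u. u / (1 - u))"
  have space_R: "space R = {0<..<1}" by (simp add: R_def space_restrict_space)
  have R_meas: "f \<in> borel_measurable R" if "f \<in> borel_measurable borel" for f :: "real \<Rightarrow> real"
    using that unfolding R_def by (intro measurable_restrict_space1) simp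
  have dens [measurable]: "(\<lambda>u. ennreal (G / (1 - u))) \<in> borel_measurable R"
    "(\<lambda>u. G / (1 - u)) \<in> borel_measurable R"
    by (auto intro!: measurable_compose[OF R_meas] R_meas)
  have push: "(\<lambda>u. u / (1 - u)) \<in> measurable N (restrict_space borel {0<..})"
    unfolding N_def by (intro measurable_restrict_space2) (auto simp: space_R intro!: R_meas)
  \<comment> \<open>The atoms at the endpoints, where the kernel is \<open>1 / x\<close> and
    \<open>x\<close>.\<close>
  define \<alpha> \<beta> where "\<alpha> = G * prob {0}" and "\<beta> = G * prob {1}"
  have "integrable \<mu> (\<lambda>t. x / (t + x\<^sup>2)) \<and>
      g x = \<alpha> / x + \<beta> * x + (\<integral>t. x / (t + x\<^sup>2) \<partial>\<mu>)"
    if "x > 0" for x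
  proof -
    have f [measurable]: "(\<lambda>t. x / (t + x\<^sup>2)) \<in> borel_measurable (restrict_space borel {0<..})"
      by (intro measurable_restrict_space1) measurable
    have fN: "(\<lambda>u. x / (u / (1 - u) + x\<^sup>2)) \<in> borel_measurable R"
      by (intro R_meas) measurable
    have kernel: "G / (1 - u) * (x / (u / (1 - u) + x\<^sup>2)) = G * loewner_kernel x u" if "u \<in> space R" for u
    proof -
      have "u + (1 - u) * x\<^sup>2 = (1 - u) * (u / (1 - u) + x\<^sup>2)"
        using that by (simp add: space_R distrib_left)
      then show ?thesis by (simp add: loewner_kernel_def)
    qed
    have int_kernel: "integrable M (loewner_kernel x)"
      using M \<open>x > 0\<close> by (intro unit_distribution_integrable loewner_kernel_continuous) auto
    then have int_ind: "integrable M (\<lambda>u. indicator {0<..<1} u * loewner_kernel x u)"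
      using integrable_mult_indicator[of "{0<..<1}" M "loewner_kernel x"] by simp
    then have "integrable R (loewner_kernel x)"
      unfolding R_def by (subst integrable_restrict_space) auto
    then have "integrable R (\<lambda>u. G / (1 - u) * (x / (u / (1 - u) + x\<^sup>2)))"
      by (subst Bochner_Integration.integrable_cong[OF refl kernel]) auto
    then have "integrable N (\<lambda>u. x / (u / (1 - u) + x\<^sup>2))"
      unfolding N_def using fN \<open>G \<ge> 0\<close>
      by (subst integrable_density) (auto simp: space_R intro!: AE_I2)
    then have int_\<mu>: "integrable \<mu> (\<lambda>t. x / (t + x\<^sup>2))"
      unfolding \<mu>_def by (subst integrable_distr_eq[OF push f])
    have "(\<integral>t. x / (t + x\<^sup>2) \<partial>\<mu>) = (\<integral>u. x / (u / (1 - u) + x\<^sup>2) \<partial>N)"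
      unfolding \<mu>_def by (rule integral_distr[OF push f])
    also have "\<dots> = (\<integral>u. G / (1 - u) * (x / (u / (1 - u) + x\<^sup>2)) \<partial>R)"
      unfolding N_def using fN \<open>G \<ge> 0\<close>
      by (subst integral_density) (auto simp: space_R intro!: AE_I2)
    also have "\<dots> = (\<integral>u. G * loewner_kernel x u \<partial>R)"
      by (rule Bochner_Integration.integral_cong[OF refl kernel])
    also have "\<dots> = G * (\<integral>u. indicator {0<..<1} u * loewner_kernel x u \<partial>M)"
      unfolding R_def by (subst integral_restrict_space) (auto simp: mult.left_commute)
    finally have int_eq: "(\<integral>t. x / (t + x\<^sup>2) \<partial>\<mu>) = G * (\<integral>u. indicator {0<..<1} u * loewner_kernel x u \<partial>M)" .
    have int_atom: "integrable M (\<lambda>u. indicator {a} u * b)" for a b :: real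
      by (intro integrable_mult_left integrable_real_indicator) (auto simp: emeasure_eq_measure)
    have "(\<integral>u. loewner_kernel x u \<partial>M) =
        (\<integral>u. indicator {0} u * (1 / x) + indicator {1} u * x + indicator {0<..<1} u * loewner_kernel x u \<partial>M)"
    proof (rule integral_cong_AE)
      show "AE u in M. loewner_kernel x u =
          indicator {0} u * (1 / x) + indicator {1} u * x + indicator {0<..<1} u * loewner_kernel x u"
        using AE by eventually_elim
          (auto simp: loewner_kernel_def indicator_def power2_eq_square)
    qed measurable
    also have "\<dots> = prob {0} / x + prob {1} * x + (\<integral>u. indicator {0<..<1} u * loewner_kernel x u \<partial>M)"
      by (simp only: Bochner_Integration.integral_add Bochner_Integration.integrable_add
          int_atom int_ind integral_mult_left_zero) simp
    finally show ?thesis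
      using int_\<mu> by (simp add: g[OF \<open>x > 0\<close>] int_eq \<alpha>_def \<beta>_def algebra_simps)
  qed
  moreover have "sets \<mu> = sets (restrict_space borel {0<..})" by (simp add: \<mu>_def)
  moreover have "0 \<le> \<alpha>" "0 \<le> \<beta>" using \<open>G \<ge> 0\<close> by (auto simp: \<alpha>_def \<beta>_def)
  ultimately show ?thesis by blast
qed

text \<open>By linearity the form splits into three parts, each nonnegative by the sum-of-squares
  identities. The term \<open>\<alpha> / x\<close> is treated as the kernel at
  \<open>t = 0\<close>.\<close>

lemma half_line_representation_imp_anti_loewner:
  assumes "\<alpha> \<ge> 0" "\<beta> \<ge> 0" and sets: "sets \<mu> = sets (restrict_space borel {0<..})"
    and int: "\<And>x. x > 0 \<Longrightarrow> integrable \<mu> (\<lambda>t. x / (t + x\<^sup>2))"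
    and g: "\<And>x. x > 0 \<Longrightarrow> g x = \<alpha> / x + \<beta> * x + (\<integral>t. x / (t + x\<^sup>2) \<partial>\<mu>)"
  shows "anti_loewner g"
  unfolding anti_loewner_iff
proof (intro allI impI)
  fix X :: "real set" and \<xi>
  assume X: "finite X" "X \<subseteq> {0<..}"
  let ?c = "loewner_coeff X \<xi>"
  have sp: "space \<mu> = {0<..}"
    using sets_eq_imp_space_eq[OF sets] by (simp add: space_restrict_space)
  have int_c: "integrable \<mu> (\<lambda>t. ?c x * (x / (t + x\<^sup>2)))" if "x \<in> X" for x
    using X(2) that by (intro integrable_mult_right int) auto
  have "(\<Sum>x\<in>X. ?c x * g x) =
      (\<Sum>x\<in>X. \<alpha> * (?c x * (x / (0 + x\<^sup>2))) + \<beta> * (?c x * x) + (\<integral>t. ?c x * (x / (t + x\<^sup>2)) \<partial>\<mu>))"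
  proof (intro sum.cong refl)
    fix x assume "x \<in> X"
    then have "x > 0" using X(2) by auto
    then show "?c x * g x =
        \<alpha> * (?c x * (x / (0 + x\<^sup>2))) + \<beta> * (?c x * x) + (\<integral>t. ?c x * (x / (t + x\<^sup>2)) \<partial>\<mu>)"
      by (simp only: g integral_mult_right_zero) (simp add: power2_eq_square algebra_simps)
  qed
  also have "\<dots> = \<alpha> * (\<Sum>x\<in>X. ?c x * (x / (0 + x\<^sup>2))) + \<beta> * (\<Sum>x\<in>X. ?c x * x)
      + (\<integral>t. (\<Sum>x\<in>X. ?c x * (x / (t + x\<^sup>2))) \<partial>\<mu>)"
    by (subst Bochner_Integration.integral_sum[OF int_c]) (simp_all add: sum.distrib sum_distrib_left)
  also have "\<dots> \<ge> 0"
  proof (intro add_nonneg_nonneg mult_nonneg_nonneg assms(1,2) integral_nonneg_AE AE_I2)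
    show "0 \<le> (\<Sum>x\<in>X. ?c x * (x / (0 + x\<^sup>2)))"
      by (subst loewner_coeff_sum_kernel[OF X]) auto
    show "0 \<le> (\<Sum>x\<in>X. ?c x * x)"
      by (simp add: loewner_coeff_sum_id[OF X])
    fix t assume "t \<in> space \<mu>"
    then show "0 \<le> (\<Sum>x\<in>X. ?c x * (x / (t + x\<^sup>2)))"
      by (subst loewner_coeff_sum_kernel[OF X]) (auto simp: sp)
  qed
  finally show "0 \<le> (\<Sum>x\<in>X. ?c x * g x)" .
qed

theorem mainTheorem3:
  fixes g :: "real \<Rightarrow> real"
  shows "anti_loewner g \<longleftrightarrow>
    (\<exists>\<alpha> \<beta> (\<mu> :: real measure).
       \<alpha> \<ge> 0 \<and> \<beta> \<ge> 0 \<and>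
       sets \<mu> = sets (restrict_space borel {0<..}) \<and>
       (\<forall>x>0. integrable \<mu> (\<lambda>t. x / (t + x\<^sup>2)) \<and>
              g x = \<alpha> / x + \<beta> * x + (\<integral>t. x / (t + x\<^sup>2) \<partial>\<mu>)))"
    (is "_ \<longleftrightarrow> ?rhs")
proof
  assume g: "anti_loewner g"
  show ?rhs
  proof (cases "g 1 = 0")
    case True
    \<comment> \<open>Here \<open>g\<close> cannot be normalised, but the growth bounds between
      \<open>x\<close> and 1 force it to vanish, and the null measure represents it.\<close>
    have "g x = 0" if "x > 0" for x
    proof -
      have "g x \<le> 0"
        using anti_loewner_growth[OF g, of 1 x] anti_loewner_growth[OF g, of x 1] that True
        by (cases "x \<ge> 1") (auto simp: mult_le_0_iff)
      with anti_loewner_nonneg[OF g that] show ?thesis by simp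
    qed
    moreover have "(\<lambda>t. x / (t + x\<^sup>2)) \<in> borel_measurable (restrict_space borel {0<..})" for x :: real
      by (intro measurable_restrict_space1) measurable
    ultimately show ?thesis
      by (intro exI[of _ 0] exI[of _ "null_measure (restrict_space borel {0<..})"]) simp
  next
    case False
    then have "g 1 > 0" using anti_loewner_nonneg[OF g, of 1] by simp
    have "anti_loewner (\<lambda>x. g x / g 1)"
      using g \<open>g 1 > 0\<close> unfolding anti_loewner_iff
      by (simp add: zero_le_divide_iff flip: sum_divide_distrib)
    then obtain M where M: "unit_distribution M"
      and eq: "\<And>x. x > 0 \<Longrightarrow> g x / g 1 = (\<integral>u. loewner_kernel x u \<partial>M)"
      using anti_loewner_unit_representation[of "\<lambda>x. g x / g 1"] False by auto
    have "g x = g 1 * (\<integral>u. loewner_kernel x u \<partial>M)" if "x > 0" for x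
      unfolding eq[OF that, symmetric] using False by simp
    then show ?thesis
      by (rule unit_representation_imp_half_line_representation[OF M less_imp_le[OF \<open>g 1 > 0\<close>]])
  qed
next
  assume ?rhs
  then obtain \<alpha> \<beta> and \<mu> :: "real measure"
    where nonneg: "\<alpha> \<ge> 0" "\<beta> \<ge> 0" and sets: "sets \<mu> = sets (restrict_space borel {0<..})"
      and rep: "\<forall>x>0. integrable \<mu> (\<lambda>t. x / (t + x\<^sup>2)) \<and>
        g x = \<alpha> / x + \<beta> * x + (\<integral>t. x / (t + x\<^sup>2) \<partial>\<mu>)"
    by (elim exE conjE) (rule that)
  show "anti_loewner g"
    by (rule half_line_representation_imp_anti_loewner[OF nonneg sets]) (use rep in simp_all)
qed

end
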